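(* Let $A$ be a real $2\times2$ constant matrix. Suppose that the system $\boldsymbol{x}'(t)=A\boldsymbol{x}(t)$, $t\in\mathbb{R}$, is Hyers-Ulam stable on $\mathbb{R}$ and that $A$ is invertible. If the real parts of the two eigenvalues of $A$ are both nonzero, then the minimal Hyers-Ulam constant $K$ satisfies $K\ge\|A^{-1}\boldsymbol{e}\|_\infty$, where $\boldsymbol{e}\in\mathbb{R}^2$ is any unit vector, i.e. any vector with $\|\boldsymbol{e}\|_\infty=1$.
   Context: For $\boldsymbol{v}=(v_1,v_2)^T\in\mathbb{R}^2$, $\|\boldsymbol{v}\|_\infty=\max\{|v_1|,|v_2|\}$. The system $\boldsymbol{x}'=A\boldsymbol{x}$ is Hyers-Ulam stable on $\mathbb{R}$ if there is a constant $K>0$ such that for every $\varepsilon>0$ and every differentiable $\boldsymbol{\phi}:\mathbb{R}\to\mathbb{R}^2$ with $\|\boldsymbol{\phi}'(t)-A\boldsymbol{\phi}(t)\|_\infty\le\varepsilon$ for all $t\in\mathbb{R}$, there exists a solution $\boldsymbol{x}:\mathbb{R}\to\mathbb{R}^2$ of $\boldsymbol{x}'=A\boldsymbol{x}$ with $\|\boldsymbol{\phi}(t)-\boldsymbol{x}(t)\|_\infty\le K\varepsilon$ for all $t\in\mathbb{R}$. Any such $K$ is called a Hyers-Ulam stability (HUS) constant. The minimal Hyers-Ulam constant is the smallest element of the set of all HUS constants; a lower bound for the minimal constant means that the bound holds for every HUS constant. *)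

theory Defs
  imports "HOL-Analysis.Analysis"
begin

text \<open>
  Vectors in the plane have type \<^typ>\<open>real ^ 2\<close>; the library's \<^const>\<open>infnorm\<close> is the
  maximum norm there.
\<close>

lemma infnorm_real2: "infnorm (v :: real ^ 2) = max \<bar>v $ 1\<bar> \<bar>v $ 2\<bar>"
proof -
  have "{\<bar>v $ i\<bar> | i. i \<in> UNIV} = {\<bar>v $ 1\<bar>, \<bar>v $ 2\<bar>}"
    using exhaust_2 by (auto, metis)
  then show ?thesis
    by (simp add: infnorm_cart cSup_eq_Max)
qed

definition linear_ode_solution :: "real ^ 2 ^ 2 \<Rightarrow> (real \<Rightarrow> real ^ 2) \<Rightarrow> bool" where
  "linear_ode_solution A x \<longleftrightarrow> (\<forall>t. (x has_vector_derivative A *v x t) (at t))"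

definition HUS_constant :: "real ^ 2 ^ 2 \<Rightarrow> real \<Rightarrow> bool" where
  "HUS_constant A K \<longleftrightarrow> K > 0 \<and>
    (\<forall>\<epsilon>>0. \<forall>\<phi> :: real \<Rightarrow> real ^ 2.
      (\<forall>t. \<phi> differentiable (at t)) \<and>
      (\<forall>t. infnorm (vector_derivative \<phi> (at t) - A *v \<phi> t) \<le> \<epsilon>) \<longrightarrow>
      (\<exists>x. linear_ode_solution A x \<and> (\<forall>t. infnorm (\<phi> t - x t) \<le> K * \<epsilon>)))"

definition Hyers_Ulam_stable :: "real ^ 2 ^ 2 \<Rightarrow> bool" where
  "Hyers_Ulam_stable A \<longleftrightarrow> (\<exists>K. HUS_constant A K)"

text \<open>
  Eigenvalues are taken over the complex numbers, since a real matrix may have a pair of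
  non-real conjugate eigenvalues.
\<close>

definition complex_eigenvalue :: "real ^ 2 ^ 2 \<Rightarrow> complex \<Rightarrow> bool" where
  "complex_eigenvalue A \<mu> \<longleftrightarrow>
    (\<exists>v :: complex ^ 2. v \<noteq> 0 \<and> map_matrix complex_of_real A *v v = \<mu> *s v)"

end

theory Submission
  imports Defs
begin

text \<open>
  Test a stability constant \<open>K\<close> on the constant curve \<open>\<phi>(t) = - A\<inverse> e\<close>, whose defect
  \<open>\<phi>' - A \<phi> = e\<close> has maximum norm one.  Some solution \<open>x\<close> then stays within distance
  \<open>K\<close> of the point \<open>c = - A\<inverse> e\<close> for all time, and \<open>\<parallel>c\<parallel> \<le> K\<close> is to be shown.

  Such an \<open>x\<close> is bounded, and averaging over time eliminates it without
  solving the system: since \<open>x\<close> is the derivative of the bounded curve \<open>A\<inverse> x\<close>, its mean over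
  \<open>[0, T]\<close> equals \<open>A\<inverse> (x(T) - x(0)) / T\<close> and tends to zero.  Hence \<open>c\<close> is the limit of the means of
  \<open>c - x\<close>, all of which lie in the closed ball of radius \<open>K\<close>
  (\<open>closed_ball_around_bounded_solution\<close>).  The average is taken one coordinate at a time, where
  the mean value theorem replaces integration (\<open>abs_le_if_close_to_bounded_derivative\<close>).
\<close>

text \<open>
  The function \<open>t \<mapsto> c * t - g t\<close> grows at rate at most \<open>K\<close>, while \<open>g\<close> contributes only a bounded
  amount; over a long time interval the slope \<open>c\<close> dominates.
\<close>

lemma abs_le_if_close_to_bounded_derivative:
  fixes g g' :: "real \<Rightarrow> real"
  assumes deriv: "\<And>t. (g has_real_derivative g' t) (at t)"
    and bound: "\<And>t. \<bar>g t\<bar> \<le> M"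
    and close: "\<And>t. \<bar>c - g' t\<bar> \<le> K"
  shows "\<bar>c\<bar> \<le> K"
proof (rule ccontr)
  assume "\<not> \<bar>c\<bar> \<le> K"
  then have gap: "\<bar>c\<bar> - K > 0" by simp
  have "M \<ge> 0" using bound[of 0] by simp
  \<comment> \<open>At this time \<open>(\<bar>c\<bar> - K) * T\<close> exceeds \<open>2 * M\<close>, a bound for the variation of \<open>g\<close>.\<close>
  define T where "T = (2 * M + 1) / (\<bar>c\<bar> - K)"
  have "T > 0" using gap \<open>M \<ge> 0\<close> by (simp add: T_def)
  have T: "(\<bar>c\<bar> - K) * T = 2 * M + 1" using gap by (simp add: T_def)
  have "((\<lambda>t. c * t - g t) has_real_derivative c - g' t) (at t)" for t
    by (auto intro!: derivative_eq_intros deriv)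
  from MVT2[OF \<open>T > 0\<close> this] obtain z where "c * T - g T - (c * 0 - g 0) = T * (c - g' z)"
    by auto
  then have eq: "c * T = T * (c - g' z) + (g T - g 0)" by simp
  have "\<bar>c\<bar> * T = \<bar>c * T\<bar>" using \<open>T > 0\<close> by (simp add: abs_mult)
  also have "\<dots> \<le> \<bar>T * (c - g' z)\<bar> + \<bar>g T - g 0\<bar>"
    unfolding eq by (rule abs_triangle_ineq)
  also have "\<bar>T * (c - g' z)\<bar> \<le> K * T"
    using \<open>T > 0\<close> close[of z] by (simp add: abs_mult)
  also have "\<bar>g T - g 0\<bar> \<le> 2 * M" using bound[of T] bound[of 0] by linarith
  finally show False using T by (simp add: algebra_simps)
qed

lemma matrix_inv_inverse:
  fixes A :: "real ^ 'n ^ 'm"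
  assumes "invertible A"
  shows "A ** matrix_inv A = mat 1" and "matrix_inv A ** A = mat 1"
  using someI_ex[OF assms[unfolded invertible_def]] by (simp_all add: matrix_inv_def)

lemma infnorm_le_iff_real2: "infnorm (v :: real ^ 2) \<le> K \<longleftrightarrow> (\<forall>i. \<bar>v $ i\<bar> \<le> K)"
  by (simp add: infnorm_real2 forall_2)

text \<open>
  Each coordinate of \<open>x\<close> is the derivative of the same coordinate of \<open>A\<inverse> x\<close>, because
  \<open>(A\<inverse> x)' = A\<inverse> A x = x\<close>, and \<open>A\<inverse> x\<close> is bounded along with \<open>x\<close>.
\<close>

lemma closed_ball_around_bounded_solution:
  fixes A :: "real ^ 2 ^ 2" and c :: "real ^ 2"
  assumes "invertible A"
    and sol: "linear_ode_solution A x"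
    and close: "\<And>t. infnorm (c - x t) \<le> K"
  shows "infnorm c \<le> K"
proof -
  define B where "B = matrix_inv A"
  have BA: "B ** A = mat 1" using \<open>invertible A\<close> by (simp add: B_def matrix_inv_inverse)
  have "bounded (range x)"
  proof (rule boundedI)
    fix y assume "y \<in> range x"
    then obtain t where "y = x t" by blast
    have "infnorm (x t) \<le> infnorm c + K"
      using infnorm_triangle[of c "x t - c"] close[of t] by (simp add: infnorm_sub)
    then have "\<bar>x t $ 1\<bar> + \<bar>x t $ 2\<bar> \<le> 2 * (infnorm c + K)"
      by (simp add: infnorm_real2)
    then show "norm y \<le> 2 * (infnorm c + K)"
      using norm_le_l1_cart[of "x t"] \<open>y = x t\<close> by (simp add: sum_2)
  qed
  then have "bounded (range (\<lambda>t. B *v x t))"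
    using bounded_linear_image[OF _ matrix_vector_mul_bounded_linear, of "range x" B]
    by (simp add: image_image)
  then obtain M where M: "\<And>t. norm (B *v x t) \<le> M" by (auto simp: bounded_iff)
  have "\<bar>c $ i\<bar> \<le> K" for i
  proof (rule abs_le_if_close_to_bounded_derivative)
    fix t
    have "((\<lambda>t. B *v x t) has_vector_derivative B *v (A *v x t)) (at t)"
      using sol by (intro bounded_linear.has_vector_derivative[OF matrix_vector_mul_bounded_linear])
        (simp add: linear_ode_solution_def)
    then have "((\<lambda>t. B *v x t) has_vector_derivative x t) (at t)"
      by (simp add: matrix_vector_mul_assoc BA)
    from bounded_linear.has_vector_derivative[OF bounded_linear_vec_nth this, of i]
    show "((\<lambda>t. (B *v x t) $ i) has_real_derivative x t $ i) (at t)"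
      by (simp add: has_real_derivative_iff_has_vector_derivative)
    show "\<bar>(B *v x t) $ i\<bar> \<le> M"
      using component_le_norm_cart[of "B *v x t" i] M[of t] by simp
    show "\<bar>c $ i - x t $ i\<bar> \<le> K"
      using close[of t] by (simp add: infnorm_le_iff_real2)
  qed
  then show ?thesis by (simp add: infnorm_le_iff_real2)
qed

theorem lemma2p2:
  fixes A :: "real ^ 2 ^ 2" and e :: "real ^ 2"
  assumes "Hyers_Ulam_stable A"
    and "invertible A"
    and "\<forall>\<mu>. complex_eigenvalue A \<mu> \<longrightarrow> Re \<mu> \<noteq> 0"
    and "infnorm e = 1"
  shows "\<forall>K. HUS_constant A K \<longrightarrow> K \<ge> infnorm (matrix_inv A *v e)"
proof (intro allI impI)
  fix K assume K: "HUS_constant A K"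
  define c where "c = - (matrix_inv A *v e)"
  have "A *v c = - e"
    using \<open>invertible A\<close> matrix_vector_mult_diff_distrib[of A 0 "matrix_inv A *v e"]
    by (simp add: c_def matrix_vector_mul_assoc matrix_inv_inverse)
  then have "infnorm (vector_derivative (\<lambda>_. c) (at t) - A *v c) \<le> 1" for t :: real
    using \<open>infnorm e = 1\<close> by simp
  then obtain x where x: "linear_ode_solution A x" "\<And>t. infnorm (c - x t) \<le> K"
    using K[unfolded HUS_constant_def, THEN conjunct2, rule_format, of 1 "\<lambda>_. c"] by auto
  have "infnorm c \<le> K"
    by (rule closed_ball_around_bounded_solution[OF \<open>invertible A\<close> x])
  then show "infnorm (matrix_inv A *v e) \<le> K"
    by (simp add: c_def infnorm_neg)
qed

end
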